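(* For all integers $1\le K\le N$, $$\dim\mathcal{C}_{N,K}=\sum_{k=0}^K\binom{N}{k},$$ where $\mathcal{C}_{N,K}=\mathcal{C}_{N,K}([2]^N;[2])$ is the set of $(N,K)$-local classical MACs with binary inputs and binary output, regarded as a subset of $\mathbb{R}^{2^{N+1}}$.
   Context: $[2]=\{0,1\}$. A multiple access channel (MAC) $[2]^N\to[2]$ is a family of conditional probabilities $p(b|a_1\cdots a_N)\ge0$ with $\sum_b p(b|a_1\cdots a_N)=1$; it is viewed as the vector of its entries in $\mathbb{R}^{2\cdot 2^N}$. $(N,K)$-local classical MACs: let $0,\mathbf{e}_1,\dots,\mathbf{e}_N$ be distinct symbols and for $S\subseteq\{1,\dots,N\}$ let $\mathcal{M}_S=\{0\}\cup\{\mathbf{e}_s:s\in S\}$. $\mathcal{C}_{N,K}([2]^N;[2])$ is the set of MACs of the form $$p(b|a_1\cdots a_N)=\sum_{S:\,|S|=K}p_S\sum_{m\in\mathcal{M}_S}d(b|m)\,q_S(m|(a_s)_{s\in S}),$$ where the outer sum is over subsets $S\subseteq\{1,\dots,N\}$ of size $K$, $(p_S)$ is a probability distribution, each $q_S$ is a stochastic map $[2]^{S}\to\mathcal{M}_S$, and $d$ is a stochastic map $\{0,\mathbf{e}_1,\dots,\mathbf{e}_N\}\to[2]$ (the same for all $S$). The dimension of a set of points in $\mathbb{R}^n$ is the dimension of its affine hull. *)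

theory Defs
  imports "HOL-Analysis.Analysis"
begin

text \<open>
  The senders \<open>1, \<dots>, N\<close> are the elements of a finite type \<open>'n\<close>, so \<open>N = CARD('n)\<close>, and
  \<open>[2] = {0, 1}\<close> is \<open>bool\<close>. A channel \<open>p\<close> is the vector with the entry
  \<open>p $ (b, a) = p(b|a\<^sub>1\<cdots>a\<^sub>N)\<close> for each of the \<open>2 \<cdot> 2^N\<close> pairs \<open>(b, a)\<close>.
\<close>

type_synonym 'n channel = "real ^ (bool \<times> ('n \<Rightarrow> bool))"

text \<open>\<open>w y x\<close> is the probability of \<open>y\<close> given \<open>x\<close>; values outside \<open>X\<close> and \<open>Y\<close> are irrelevant.\<close>

definition stochastic_map :: "'x set \<Rightarrow> 'y set \<Rightarrow> ('y \<Rightarrow> 'x \<Rightarrow> real) \<Rightarrow> bool" where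
  "stochastic_map X Y w \<longleftrightarrow> (\<forall>x\<in>X. (\<forall>y\<in>Y. 0 \<le> w y x) \<and> (\<Sum>y\<in>Y. w y x) = 1)"

definition is_mac :: "('n::finite) channel \<Rightarrow> bool" where
  "is_mac p \<longleftrightarrow> stochastic_map UNIV UNIV (\<lambda>b a. p $ (b, a))"

text \<open>The symbol \<open>0\<close> is \<open>None\<close> and \<open>\<^bold>e\<^sub>s\<close> is \<open>Some s\<close>.\<close>

definition messages :: "'n set \<Rightarrow> 'n option set" where
  "messages S = insert None (Some ` S)"

text \<open>
  The tuple \<open>(a\<^sub>s)\<close> with \<open>s \<in> S\<close> is \<open>restrict a S\<close>, an element of \<open>S \<rightarrow>\<^sub>E UNIV\<close>,
  the encoding of \<open>[2]\<close> to the power \<open>S\<close>.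
\<close>

definition local_macs :: "nat \<Rightarrow> ('n::finite) channel set" where
  "local_macs K = {p. is_mac p \<and>
     (\<exists>(pS :: 'n set \<Rightarrow> real)
        (q :: 'n set \<Rightarrow> 'n option \<Rightarrow> ('n \<Rightarrow> bool) \<Rightarrow> real)
        (d :: bool \<Rightarrow> 'n option \<Rightarrow> real).
        (\<forall>S. card S = K \<longrightarrow> 0 \<le> pS S) \<and>
        (\<Sum>S | card S = K. pS S) = 1 \<and>
        (\<forall>S. card S = K \<longrightarrow> stochastic_map (S \<rightarrow>\<^sub>E UNIV) (messages S) (q S)) \<and>
        stochastic_map UNIV UNIV d \<and>
        (\<forall>b a. p $ (b, a) =
           (\<Sum>S | card S = K. pS S * (\<Sum>m\<in>messages S. d b m * q S m (restrict a S)))))}"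

end

theory Submission
  imports Defs
begin

text \<open>
  A binary-output channel is determined by \<open>f a = p(0|a)\<close>. For a \<open>K\<close>-local channel \<open>f\<close> is a
  mixture of functions of at most \<open>K\<close> inputs, hence a linear combination of the monomials
  \<open>\<Prod>\<^sub>t\<^sub>\<in>\<^sub>T a\<^sub>t\<close> with \<open>|T| \<le> K\<close>. Conversely, the decoder that outputs \<open>1\<close> exactly on the
  message \<open>0\<close> realises \<open>f = 0\<close> and, because \<open>K \<ge> 1\<close>, each of these monomials. The monomials
  are linearly independent, so together with \<open>0\<close> they affinely span a space whose dimension is
  their number.
\<close>

definition monomial :: "'n set \<Rightarrow> ('n \<Rightarrow> bool) \<Rightarrow> real" where
  "monomial T a = of_bool (\<forall>t\<in>T. a t)"

text \<open>The opposite signs make the two outputs cancel for every input, so this linear embedding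
  of functions has as its image the differences of normalised vectors.\<close>

definition deviation :: "(('n \<Rightarrow> bool) \<Rightarrow> real) \<Rightarrow> ('n::finite) channel" where
  "deviation f = (\<chi> i. if fst i then - f (snd i) else f (snd i))"

text \<open>The channel with \<open>f = 0\<close>, used as the base point from which other channels
  are measured.\<close>

definition constant_one :: "('n::finite) channel" where
  "constant_one = (\<chi> i. of_bool (fst i))"

lemma deviation_nth [simp]: "deviation f $ (b, a) = (if b then - f a else f a)"
  by (simp add: deviation_def)

lemma constant_one_nth [simp]: "constant_one $ (b, a) = of_bool b"
  by (simp add: constant_one_def)

lemma deviation_sum:
  "deviation (\<lambda>a. \<Sum>i\<in>I. c i * f i a) = (\<Sum>i\<in>I. c i *\<^sub>R deviation (f i))"
  by (auto simp: vec_eq_iff sum_negf)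

lemma is_mac_eq_deviation:
  assumes "is_mac p"
  shows "p = constant_one + deviation (\<lambda>a. p $ (False, a))"
proof -
  have "p $ (False, a) + p $ (True, a) = 1" for a
    using assms by (simp add: is_mac_def stochastic_map_def UNIV_bool)
  then have "p $ (True, a) = 1 - p $ (False, a)" for a
    by (metis add_diff_cancel_left')
  then have "p $ (b, a) = (constant_one + deviation (\<lambda>a. p $ (False, a))) $ (b, a)" for b a
    by (cases b) simp_all
  then show ?thesis
    unfolding vec_eq_iff by fast
qed

text \<open>Induction on \<open>S\<close> with the split \<open>f = f0 + a s * (f1 - f0)\<close>,
  where \<open>f0\<close> and \<open>f1\<close> are \<open>f\<close> with input \<open>s\<close>
  fixed to 0 and to 1. Both depend on the remaining inputs only.\<close>

lemma monomial_expansion: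
  assumes "finite S" and "\<And>a b. (\<forall>s\<in>S. a s = b s) \<Longrightarrow> f a = f b"
  shows "\<exists>c. \<forall>a. f a = (\<Sum>T\<in>Pow S. c T * monomial T a)"
  using assms
proof (induction S arbitrary: f rule: finite_induct)
  case empty
  then have "f a = f b" for a b
    by blast
  then show ?case
    by (intro exI[of _ "\<lambda>_. f (\<lambda>_. False)"]) (simp add: monomial_def)
next
  case (insert s S)
  let ?f0 = "\<lambda>a. f (a(s := False))" and ?f1 = "\<lambda>a. f (a(s := True))"
  have "\<exists>c. \<forall>a. ?f0 a = (\<Sum>T\<in>Pow S. c T * monomial T a)"
    by (rule insert.IH) (auto intro!: insert.prems)
  then obtain c0 where c0: "?f0 a = (\<Sum>T\<in>Pow S. c0 T * monomial T a)" for a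
    by blast
  have "\<exists>c. \<forall>a. ?f1 a = (\<Sum>T\<in>Pow S. c T * monomial T a)"
    by (rule insert.IH) (auto intro!: insert.prems)
  then obtain c1 where c1: "?f1 a = (\<Sum>T\<in>Pow S. c1 T * monomial T a)" for a
    by blast
  \<comment> \<open>In the split, sets without \<open>s\<close> come from \<open>f0\<close>;
    multiplying \<open>f1 - f0\<close> by the input of \<open>s\<close> inserts \<open>s\<close>
    into each set.\<close>
  define c where "c T = (if s \<in> T then c1 (T - {s}) - c0 (T - {s}) else c0 T)" for T
  have inj: "inj_on (insert s) (Pow S)"
    using insert.hyps by (auto simp: inj_on_def)
  have disj: "Pow S \<inter> insert s ` Pow S = {}"
    using insert.hyps by auto
  have "f a = (\<Sum>T\<in>Pow (insert s S). c T * monomial T a)" for a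
  proof -
    have "(\<Sum>T\<in>Pow (insert s S). c T * monomial T a) =
        (\<Sum>T\<in>Pow S. c T * monomial T a) + (\<Sum>T\<in>Pow S. c (insert s T) * monomial (insert s T) a)"
      using insert.hyps disj
      by (simp add: Pow_insert sum.union_disjoint sum.reindex[OF inj])
    also have "(\<Sum>T\<in>Pow S. c T * monomial T a) = ?f0 a"
      unfolding c0 using insert.hyps by (intro sum.cong) (auto simp: c_def)
    also have "(\<Sum>T\<in>Pow S. c (insert s T) * monomial (insert s T) a) =
        (\<Sum>T\<in>Pow S. of_bool (a s) * (c1 T * monomial T a - c0 T * monomial T a))"
    proof (intro sum.cong refl)
      fix T assume "T \<in> Pow S"
      then have "insert s T - {s} = T"
        using insert.hyps by auto
      then show "c (insert s T) * monomial (insert s T) a =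
          of_bool (a s) * (c1 T * monomial T a - c0 T * monomial T a)"
        by (simp add: c_def monomial_def algebra_simps)
    qed
    also have "\<dots> = of_bool (a s) * (?f1 a - ?f0 a)"
      unfolding c0 c1 by (simp add: sum_distrib_left sum_subtractf)
    also have "?f0 a + of_bool (a s) * (?f1 a - ?f0 a) = f a"
      by (cases "a s") (simp_all add: fun_upd_idem)
    finally show ?thesis ..
  qed
  then show ?case
    by blast
qed

text \<open>Triangularity with respect to inclusion: at the indicator of \<open>R\<close>,
  \<open>monomial T\<close> is 1 if \<open>T\<close> is a subset of \<open>R\<close> and 0
  otherwise. Proper subsets of \<open>R\<close> have coefficient 0 by induction, so the sum reduces
  to \<open>c R\<close>.\<close>

lemma monomial_combination_zero:
  assumes "finite F" and "\<And>a. (\<Sum>T\<in>F. c T * monomial T a) = 0"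
    and "finite R" and "R \<in> F"
  shows "c R = 0"
  using assms(3,4)
proof (induction R rule: finite_psubset_induct)
  case (psubset R)
  have "c T * monomial T (\<lambda>t. t \<in> R) = 0" if "T \<in> F - {R}" for T
  proof (cases "T \<subset> R")
    case True
    then show ?thesis
      using psubset.IH that by auto
  next
    case False
    then show ?thesis
      using that by (auto simp: monomial_def)
  qed
  then have "(\<Sum>T\<in>F - {R}. c T * monomial T (\<lambda>t. t \<in> R)) = 0"
    by (rule sum.neutral[rule_format])
  then have "(\<Sum>T\<in>F. c T * monomial T (\<lambda>t. t \<in> R)) = c R"
    by (subst sum.remove[OF assms(1) psubset.prems]) (simp add: monomial_def)
  then show ?case
    using assms(2) by simp
qed

lemma inj_deviation_monomial: "inj (\<lambda>T :: ('n::finite) set. deviation (monomial T))"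
proof (rule injI)
  fix T R :: "'n set"
  assume "deviation (monomial T) = deviation (monomial R)"
  then have eq: "monomial T a = monomial R a" for a
    by (metis deviation_nth)
  have "T \<subseteq> R" using eq[of "\<lambda>t. t \<in> R"] by (auto simp: monomial_def)
  moreover have "R \<subseteq> T" using eq[of "\<lambda>t. t \<in> T"] by (auto simp: monomial_def)
  ultimately show "T = R" by blast
qed

lemma independent_deviation_monomial:
  "independent ((\<lambda>T :: ('n::finite) set. deviation (monomial T)) ` F)"
proof -
  let ?u = "\<lambda>T :: 'n set. deviation (monomial T)"
  have inj: "inj_on ?u F"
    using inj_deviation_monomial by (rule inj_on_subset) simp
  have "c (?u R) = 0" if "(\<Sum>v\<in>?u ` F. c v *\<^sub>R v) = 0" and "R \<in> F" for c R
  proof (rule monomial_combination_zero[of F "\<lambda>T. c (?u T)"])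
    fix a
    have "deviation (\<lambda>a. \<Sum>T\<in>F. c (?u T) * monomial T a) = 0"
      using that(1) by (simp add: sum.reindex[OF inj] deviation_sum)
    \<comment> \<open>The entries with output \<open>False\<close> already recover the
      function.\<close>
    then have "deviation (\<lambda>a. \<Sum>T\<in>F. c (?u T) * monomial T a) $ (False, a) = 0"
      by simp
    then show "(\<Sum>T\<in>F. c (?u T) * monomial T a) = 0"
      by simp
  qed (use that in auto)
  then show ?thesis
    by (auto simp: dependent_finite)
qed

text \<open>The expansion uses only subsets of \<open>S\<close>, and these have at most
  \<open>K\<close> elements.\<close>

lemma deviation_local_in_span:
  fixes S :: "('n::finite) set"
  assumes "card S \<le> K" and "\<And>a b. (\<forall>s\<in>S. a s = b s) \<Longrightarrow> f a = f b"
  shows "deviation f \<in> span ((\<lambda>T. deviation (monomial T)) ` {T. card T \<le> K})"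
proof -
  obtain c where "f a = (\<Sum>T\<in>Pow S. c T * monomial T a)" for a
    using monomial_expansion[of S f] assms(2) by auto
  then have "f = (\<lambda>a. \<Sum>T\<in>Pow S. c T * monomial T a)"
    by blast
  then have "deviation f = (\<Sum>T\<in>Pow S. c T *\<^sub>R deviation (monomial T))"
    by (simp add: deviation_sum)
  also have "\<dots> \<in> span ((\<lambda>T. deviation (monomial T)) ` {T. card T \<le> K})"
  proof (intro span_sum span_scale span_base imageI CollectI)
    fix T assume "T \<in> Pow S"
    then show "card T \<le> K"
      using assms(1) card_mono[of S T] by auto
  qed
  finally show ?thesis .
qed

lemma local_macs_minus_constant_in_span:
  assumes "(p :: ('n::finite) channel) \<in> local_macs K"
  shows "p - constant_one \<in> span ((\<lambda>T. deviation (monomial T)) ` {T. card T \<le> K})"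
proof -
  obtain pS and q :: "'n set \<Rightarrow> 'n option \<Rightarrow> ('n \<Rightarrow> bool) \<Rightarrow> real" and d
    where mac: "is_mac p" and
      p: "p $ (b, a) =
        (\<Sum>S | card S = K. pS S * (\<Sum>m\<in>messages S. d b m * q S m (restrict a S)))" for b a
    using assms unfolding local_macs_def by blast
  \<comment> \<open>\<open>g S a\<close> is the probability of output 0 once \<open>S\<close> is
    selected; it sees \<open>a\<close> only through \<open>restrict a S\<close>.\<close>
  define g where "g S a = (\<Sum>m\<in>messages S. d False m * q S m (restrict a S))" for S a
  have "p - constant_one = deviation (\<lambda>a. p $ (False, a))"
    using is_mac_eq_deviation[OF mac] by (metis add_diff_cancel_left')
  also have "\<dots> = (\<Sum>S | card S = K. pS S *\<^sub>R deviation (g S))"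
    unfolding p g_def by (rule deviation_sum)
  also have "\<dots> \<in> span ((\<lambda>T. deviation (monomial T)) ` {T. card T \<le> K})"
  proof (intro span_sum span_scale deviation_local_in_span)
    fix S :: "'n set" and a b :: "'n \<Rightarrow> bool"
    assume "\<forall>s\<in>S. a s = b s"
    then have "restrict a S = restrict b S"
      by (intro restrict_ext) simp
    then show "g S a = g S b"
      by (simp add: g_def)
  qed auto
  finally show ?thesis .
qed

text \<open>Always select \<open>S\<close> and fix one sender \<open>s\<close> in it, which exists
  as \<open>K\<close> is positive. Sending \<open>Some s\<close> with probability \<open>f a\<close>
  and \<open>None\<close> otherwise makes the decoder output 0 with probability
  \<open>f a\<close>.\<close>

lemma local_function_in_local_macs:
  fixes S :: "('n::finite) set"
  assumes S: "card S = K" and "1 \<le> K"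
    and f_bounds: "\<And>a. 0 \<le> f a" "\<And>a. f a \<le> 1"
    and f_local: "\<And>a. f (restrict a S) = f a"
  shows "constant_one + deviation f \<in> local_macs K"
proof -
  obtain s where s: "s \<in> S"
    using S \<open>1 \<le> K\<close> by fastforce
  define pS :: "'n set \<Rightarrow> real" where "pS S' = of_bool (S' = S)" for S'
  define d :: "bool \<Rightarrow> 'n option \<Rightarrow> real" where "d b m = of_bool (b \<longleftrightarrow> m = None)" for b m
  \<comment> \<open>A set \<open>S'\<close> other than \<open>S\<close> has weight 0 but still needs
    a stochastic encoder, and may lack \<open>s\<close>; with \<open>h = 0\<close> it always sends
    \<open>None\<close>.\<close>
  define h where "h S' a = (if S' = S then f a else 0)" for S' a
  define q where "q S' m a =
      (case m of None \<Rightarrow> 1 - h S' a | Some t \<Rightarrow> if t = s then h S' a else 0)"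
    for S' m a
  have sum_messages: "(\<Sum>m\<in>messages S'. w m) = w None + (\<Sum>t\<in>S'. w (Some t))"
    for S' :: "'n set" and w :: "'n option \<Rightarrow> real"
    by (simp add: messages_def sum.reindex)
  have "stochastic_map (S' \<rightarrow>\<^sub>E UNIV) (messages S') (q S')" for S'
    using s f_bounds
    by (auto simp: stochastic_map_def sum_messages q_def h_def sum.delta split: option.split)
  moreover have "stochastic_map UNIV UNIV d"
    by (simp add: stochastic_map_def d_def UNIV_bool del: sum_of_bool_eq)
  moreover have "(constant_one + deviation f) $ (b, a) =
      (\<Sum>S' | card S' = K. pS S' * (\<Sum>m\<in>messages S'. d b m * q S' m (restrict a S')))" for b a
  proof -
    have "(\<Sum>S' | card S' = K. pS S' * (\<Sum>m\<in>messages S'. d b m * q S' m (restrict a S'))) =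
        (\<Sum>m\<in>messages S. d b m * q S m (restrict a S))"
      using S by (simp add: pS_def of_bool_def if_distrib[of "\<lambda>x. x * _"] sum.delta cong: if_cong)
    also have "\<dots> = (constant_one + deviation f) $ (b, a)"
      using s by (cases b) (auto simp: sum_messages d_def q_def h_def f_local sum.delta)
    finally show ?thesis ..
  qed
  moreover have "(\<Sum>S' | card S' = K. pS S') = 1"
    using S by (simp add: pS_def of_bool_def sum.delta)
  moreover have "is_mac (constant_one + deviation f)"
    using f_bounds by (auto simp: is_mac_def stochastic_map_def UNIV_bool)
  moreover have "0 \<le> pS S'" for S'
    by (simp add: pS_def)
  ultimately show ?thesis
    unfolding local_macs_def by blast
qed

lemma card_subsets_card_le:
  "card {T :: ('n::finite) set. card T \<le> K} = (\<Sum>k=0..K. CARD('n) choose k)"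
proof -
  have "{T :: 'n set. card T \<le> K} = (\<Union>k\<in>{0..K}. {T. card T = k})"
    by auto
  also have "card \<dots> = (\<Sum>k=0..K. card {T :: 'n set. card T = k})"
    by (rule card_UN_disjoint) auto
  also have "\<dots> = (\<Sum>k=0..K. CARD('n) choose k)"
    using n_subsets[of "UNIV :: 'n set"] by simp
  finally show ?thesis .
qed

theorem theorem2:
  fixes K :: nat
  assumes "1 \<le> K" and "K \<le> CARD('n::finite)"
  shows "aff_dim (local_macs K :: 'n channel set) = int (\<Sum>k=0..K. CARD('n) choose k)"
proof -
  define U where "U = (\<lambda>T :: 'n set. deviation (monomial T)) ` {T. card T \<le> K}"
  \<comment> \<open>Translation preserves affine dimension and moves \<open>constant_one\<close> to
    the origin, so that linear dimension can be computed instead.\<close>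
  define L where "L = (+) (- constant_one) ` (local_macs K :: 'n channel set)"
  have in_L: "deviation f \<in> L"
    if "constant_one + deviation f \<in> local_macs K" for f :: "('n \<Rightarrow> bool) \<Rightarrow> real"
    using imageI[OF that, of "(+) (- constant_one)"] by (simp add: L_def)
  have "deviation (monomial T) \<in> L" if T: "card T \<le> K" for T :: "'n set"
  proof -
    \<comment> \<open>Channels select sets of size exactly \<open>K\<close>, so a smaller
      \<open>T\<close> is enlarged; this is possible since \<open>K\<close> is at most the number of
      senders.\<close>
    obtain S where "T \<subseteq> S" "card S = K"
      using exists_subset_between[of T K UNIV] T assms(2) by auto
    then show ?thesis
      using assms(1)
      by (intro in_L local_function_in_local_macs[of S]) (auto simp: monomial_def)
  qed
  then have "U \<subseteq> L"
    by (auto simp: U_def)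
  moreover have "L \<subseteq> span U"
    using local_macs_minus_constant_in_span by (auto simp: L_def U_def)
  \<comment> \<open>\<open>U\<close> is an independent subset of \<open>L\<close> that spans it,
    hence a basis of the span of \<open>L\<close>.\<close>
  ultimately have "dim L = card U"
    using independent_deviation_monomial by (intro dim_unique[of U]) (auto simp: U_def)
  moreover have "card U = (\<Sum>k=0..K. CARD('n) choose k)"
    unfolding U_def card_subsets_card_le[symmetric]
    by (rule card_image, rule inj_on_subset[OF inj_deviation_monomial]) simp
  \<comment> \<open>With the origin in \<open>L\<close>, its affine hull is its linear span. The
    origin is the deviation of the zero function, realised with any \<open>S\<close> of size
    \<open>K\<close>.\<close>
  moreover have "0 \<in> L"
  proof -
    obtain S :: "'n set" where "card S = K"
      using obtain_subset_with_card_n[OF assms(2)] by blast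
    then have "deviation (\<lambda>_. 0) \<in> L"
      using assms(1) by (intro in_L local_function_in_local_macs[of S]) simp_all
    moreover have "deviation (\<lambda>_. 0) = (0 :: 'n channel)"
      by (auto simp: vec_eq_iff)
    ultimately show ?thesis
      by simp
  qed
  then have "aff_dim L = int (dim L)"
    by (intro aff_dim_zero hull_inc)
  moreover have "aff_dim L = aff_dim (local_macs K :: 'n channel set)"
    unfolding L_def by (rule aff_dim_translation_eq)
  ultimately show ?thesis
    by simp
qed

end
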